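(* Let $\mathbb{F}$ be a field, let $m>n$ be positive integers, and let $(A,B)$ be an indecomposable pair of commuting nilpotent $(m+n)\times(m+n)$ matrices over $\mathbb{F}$ such that $A$ is similar to $J_m\oplus J_n$. Then $(A,B)$ is similar to a pair of one of the following two types, for some integer $r$ with $1\le r\le n$ and some parameters in $\mathbb{F}$: (I) $(J_m\oplus J_n,\,B_{m,n,r})$, where $B_{m,n,r}=T_{m,n}(a;b;c;d)$ with - $a_0=0$, $a_1,\dots,a_{m-r-1}\in\mathbb{F}$ arbitrary, $a_i=0$ for $m-r\le i\le m-1$; - $b_i=0$ for $0\le i<n-r$, and $b_{n-r},\dots,b_{n-1}\in\mathbb{F}$ arbitrary; - $c_{n-r}=1$ and $c_i=0$ for all other $i$; - $d_i=a_i$ for $0\le i\le n-r$, and $d_{n-r+1},\dots,d_{n-1}\in\mathbb{F}$ arbitrary; (II) $(J_m\oplus J_n,\,B'_{m,n,r})$, where $B'_{m,n,r}=T_{m,n}(a;b;c;d)$ with - $a_0=0$, $a_1,\dots,a_{m-r-1}\in\mathbb{F}$ arbitrary, $a_i=0$ for $m-r\le i\le m-1$; - $b_{n-r}=1$ and $b_i=0$ for all other $i$; - $c_i=0$ for $0\le i\le n-r$, and $c_{n-r+1},\dots,c_{n-1}\in\mathbb{F}$ arbitrary; - $d_i=a_i$ for $0\le i\le n-r$, and $d_{n-r+1},\dots,d_{n-1}\in\mathbb{F}$ arbitrary. Furthermore, two pairs each of which is of type (I) or type (II) (for the same $m,n$, with any values of $r$ and any parameters) are similar if and only if they are identical.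
   Context: Two pairs $(A,B)$, $(C,D)$ of $N\times N$ matrices over a field $\mathbb{F}$ are similar if there is a non-singular $X$ over $\mathbb{F}$ with $X^{-1}AX=C$ and $X^{-1}BX=D$. A pair $(A,B)$ is a commuting nilpotent pair if $AB=BA$ and $A$, $B$ are nilpotent. $M\oplus N$ denotes the block diagonal matrix with diagonal blocks $M,N$. A pair $(A,B)$ is decomposable if it is similar to a pair $(A_1\oplus A_2,B_1\oplus B_2)$ where $A_1,B_1$ are square of the same size, $A_2,B_2$ are square of the same size, and both sizes are at least $1$; otherwise it is indecomposable. $J_k$ is the $k\times k$ nilpotent Jordan block with $1$'s on the superdiagonal and $0$ elsewhere. For $m>n\ge1$, $s=m-n$, and scalars $a=(a_0,\dots,a_{m-1})$, $b=(b_0,\dots,b_{n-1})$, $c=(c_0,\dots,c_{n-1})$, $d=(d_0,\dots,d_{n-1})$ in $\mathbb{F}$, let $T_{m,n}(a;b;c;d)$ be the $(m+n)\times(m+n)$ block matrix $\begin{bmatrix}P&Q\\R&S\end{bmatrix}$ with $P$ of size $m\times m$, $P_{ij}=a_{j-i}$; $Q$ of size $m\times n$, $Q_{ij}=b_{j-i}$; $R$ of size $n\times m$, $R_{ij}=c_{j-i-s}$; $S$ of size $n\times n$, $S_{ij}=d_{j-i}$; where entries with a negative subscript are $0$. (The matrices commuting with $J_m\oplus J_n$ are exactly the matrices $T_{m,n}(a;b;c;d)$.) *)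

theory Defs
  imports "Jordan_Normal_Form.Jordan_Normal_Form"
begin

(* similar_mat_wit C A Y X says C = Y * A * X with Y, X mutually inverse, so Y is the
   inverse of X; the same X conjugates both components. *)
definition similar_pair ::
    "'a::field mat \<times> 'a mat \<Rightarrow> 'a mat \<times> 'a mat \<Rightarrow> bool" where
  "similar_pair p q \<longleftrightarrow>
     (\<exists>X Y. similar_mat_wit (fst q) (fst p) Y X \<and> similar_mat_wit (snd q) (snd p) Y X)"

definition nilpotent_mat :: "'a::field mat \<Rightarrow> bool" where
  "nilpotent_mat A \<longleftrightarrow> square_mat A \<and> (\<exists>k. A ^\<^sub>m k = 0\<^sub>m (dim_row A) (dim_row A))"

definition commuting_nilpotent_pair :: "nat \<Rightarrow> 'a::field mat \<times> 'a mat \<Rightarrow> bool" where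
  "commuting_nilpotent_pair N p \<longleftrightarrow>
     fst p \<in> carrier_mat N N \<and> snd p \<in> carrier_mat N N \<and>
     fst p * snd p = snd p * fst p \<and> nilpotent_mat (fst p) \<and> nilpotent_mat (snd p)"

definition direct_sum_mat :: "'a::zero mat \<Rightarrow> 'a mat \<Rightarrow> 'a mat"  (infixr "\<oplus>\<^sub>d" 65) where
  "M \<oplus>\<^sub>d N = diag_block_mat [M, N]"

definition decomposable_pair :: "'a::field mat \<times> 'a mat \<Rightarrow> bool" where
  "decomposable_pair p \<longleftrightarrow>
     (\<exists>k l A1 B1 A2 B2. 1 \<le> k \<and> 1 \<le> l \<and>
        A1 \<in> carrier_mat k k \<and> B1 \<in> carrier_mat k k \<and>
        A2 \<in> carrier_mat l l \<and> B2 \<in> carrier_mat l l \<and>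
        similar_pair p (A1 \<oplus>\<^sub>d A2, B1 \<oplus>\<^sub>d B2))"

abbreviation indecomposable_pair :: "'a::field mat \<times> 'a mat \<Rightarrow> bool" where
  "indecomposable_pair p \<equiv> \<not> decomposable_pair p"

definition J_sum :: "nat \<Rightarrow> nat \<Rightarrow> 'a::field mat" where
  "J_sum m n = jordan_block m 0 \<oplus>\<^sub>d jordan_block n 0"

(* The r x c matrix with (i,j) entry x_(j-i-s), where entries with negative subscript are 0. *)
definition shifted_toeplitz ::
    "nat \<Rightarrow> nat \<Rightarrow> nat \<Rightarrow> (nat \<Rightarrow> 'a::zero) \<Rightarrow> 'a mat" where
  "shifted_toeplitz r c s x = mat r c (\<lambda>(i, j). if i + s \<le> j then x (j - (i + s)) else 0)"

(* Scalar tuples are functions on nat. For n < m only the values a i with i < m and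
   b i, c i, d i with i < n occur in the matrix. *)
definition T_mat ::
    "nat \<Rightarrow> nat \<Rightarrow> (nat \<Rightarrow> 'a::field) \<Rightarrow> (nat \<Rightarrow> 'a) \<Rightarrow> (nat \<Rightarrow> 'a) \<Rightarrow> (nat \<Rightarrow> 'a) \<Rightarrow> 'a mat" where
  "T_mat m n a b c d =
     four_block_mat (shifted_toeplitz m m 0 a) (shifted_toeplitz m n 0 b)
                    (shifted_toeplitz n m (m - n) c) (shifted_toeplitz n n 0 d)"

definition type_I :: "nat \<Rightarrow> nat \<Rightarrow> nat \<Rightarrow> ('a::field mat \<times> 'a mat) set" where
  "type_I m n r = {(J_sum m n, T_mat m n a b c d) | a b c d.
     a 0 = 0 \<and> (\<forall>i. m - r \<le> i \<and> i \<le> m - 1 \<longrightarrow> a i = 0) \<and>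
     (\<forall>i < n - r. b i = 0) \<and>
     (\<forall>i < n. c i = (if i = n - r then 1 else 0)) \<and>
     (\<forall>i \<le> n - r. d i = a i)}"

definition type_II :: "nat \<Rightarrow> nat \<Rightarrow> nat \<Rightarrow> ('a::field mat \<times> 'a mat) set" where
  "type_II m n r = {(J_sum m n, T_mat m n a b c d) | a b c d.
     a 0 = 0 \<and> (\<forall>i. m - r \<le> i \<and> i \<le> m - 1 \<longrightarrow> a i = 0) \<and>
     (\<forall>i < n. b i = (if i = n - r then 1 else 0)) \<and>
     (\<forall>i \<le> n - r. c i = 0) \<and>
     (\<forall>i \<le> n - r. d i = a i)}"

definition normal_forms :: "nat \<Rightarrow> nat \<Rightarrow> ('a::field mat \<times> 'a mat) set" where
  "normal_forms m n = (\<Union>r\<in>{1..n}. type_I m n r \<union> type_II m n r)"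

end

theory Submission
  imports Defs "HOL-Computational_Algebra.Formal_Power_Series"
begin

text \<open>
  A commuting pair whose first matrix is \<open>J_m \<oplus> J_n\<close> is an endomorphism of the module
  \<open>F[x]/x^m \<oplus> F[x]/x^n\<close>, and similarity of such pairs is conjugation by automorphisms of that
  module. With \<open>s = m - n > 0\<close>, endomorphisms are \<open>2 \<times> 2\<close> matrices over power series with
  rows \<open>(a, X^s b)\<close> and \<open>(c, d)\<close>, where \<open>a\<close> is taken modulo \<open>X^m\<close> and \<open>b\<close>, \<open>c\<close>, \<open>d\<close>
  modulo \<open>X^n\<close>; such a matrix is invertible iff \<open>a(0)\<close> and \<open>d(0)\<close> are nonzero. The lemma
  \<open>similar_pair_endo_iff\<close> carries out this translation, after which everything is algebra with
  power series.

  Existence. Let \<open>k\<close> be the least order of vanishing among \<open>a - d\<close>, \<open>b\<close>, \<open>c\<close>; it is an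
  invariant, being the largest \<open>k\<close> for which the matrix is a power series times the identity
  plus \<open>X^k\<close> times an endomorphism. If \<open>k \<ge> n\<close> the matrix is block diagonal.
  If \<open>a - d\<close> attains the order \<open>k\<close>, then modulo \<open>X\<close> the
  rescaled matrix has two distinct eigenvalues, which lift, and the pair decomposes
  (\<open>diagonalizable_if_difference_dominates\<close>). Otherwise \<open>c\<close> or \<open>b\<close> attains it. Conjugation by
  a diagonal matrix turns that entry into \<open>X^k\<close>, and a unitriangular conjugation uses it to
  remove the coefficients of \<open>a\<close> from degree \<open>s + k\<close> on (\<open>reduce_to_type_I\<close>,
  \<open>reduce_to_type_II\<close>). This is a normal form with \<open>r = n - k\<close>. Nilpotency contributes
  \<open>a(0) = 0\<close>.

  Uniqueness. Comparing coefficients of degree \<open>k\<close> shows that \<open>k\<close> and the type are invariants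
  (\<open>intertwines_leading_coefficients\<close>). For two forms of the first type with the same \<open>k\<close>, the
  degree bound on \<open>a\<close> makes the upper left entries equal, and the remaining congruences combine
  into a unit times the difference of the parameters in \<open>d\<close>
  (\<open>type_I_parameters_unique\<close>). The second type follows by transposing (\<open>intertwines_dual\<close>).
\<close>

section \<open>Toeplitz blocks as truncated power series\<close>

lemma fps_X_power_dvd_iff:
  fixes f :: "'a::comm_ring_1 fps"
  shows "fps_X ^ n dvd f \<longleftrightarrow> (\<forall>i<n. fps_nth f i = 0)"
proof
  assume "fps_X ^ n dvd f"
  then show "\<forall>i<n. fps_nth f i = 0"
    by (auto elim!: dvdE simp: fps_X_power_mult_nth)
next
  assume "\<forall>i<n. fps_nth f i = 0"
  then have "f = fps_X ^ n * fps_shift n f"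
    by (intro fps_ext) (auto simp: fps_X_power_mult_nth)
  then show "fps_X ^ n dvd f" by (rule dvdI)
qed

lemma fps_unit_cancel_dvd:
  fixes p g :: "'a::field fps"
  assumes "fps_nth p 0 \<noteq> 0" and "f dvd p * g"
  shows "f dvd g"
proof -
  have "g = inverse p * (p * g)"
    using inverse_mult_eq_1[OF assms(1)] by (simp flip: mult.assoc)
  with assms(2) show ?thesis by (metis dvd_mult)
qed

lemma shifted_toeplitz_carrier [simp]: "shifted_toeplitz r c s x \<in> carrier_mat r c"
  by (simp add: shifted_toeplitz_def)

text \<open>
  The bound on \<open>c\<close> says that the summation index of an entry is never cut off by the
  inner dimension \<open>k\<close>; under it the entry is a full coefficient of the Cauchy product.
\<close>
lemma shifted_toeplitz_mult:
  fixes f g :: "'a::field fps"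
  assumes "c \<le> k + s'"
  shows "shifted_toeplitz r k s (fps_nth f) * shifted_toeplitz k c s' (fps_nth g)
       = shifted_toeplitz r c (s + s') (fps_nth (f * g))" (is "?F * ?G = ?H")
proof (rule eq_matI)
  fix i l
  assume "i < dim_row ?H" and "l < dim_col ?H"
  then have i: "i < r" and l: "l < c" by (simp_all add: shifted_toeplitz_def)
  let ?u = "\<lambda>j. (if i + s \<le> j then fps_nth f (j - (i + s)) else 0) *
                 (if j + s' \<le> l then fps_nth g (l - (j + s')) else 0)"
  have prod: "(?F * ?G) $$ (i, l) = (\<Sum>j<k. ?u j)"
    using i l by (simp add: shifted_toeplitz_def scalar_prod_def atLeast0LessThan)
  show "(?F * ?G) $$ (i, l) = ?H $$ (i, l)"
  proof (cases "i + (s + s') \<le> l")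
    case True
    define e where "e = l - (i + (s + s'))"
    have "(\<Sum>j<k. ?u j) = (\<Sum>j\<in>{i + s..i + s + e}. ?u j)"
      using assms l True by (intro sum.mono_neutral_right) (auto simp: e_def)
    also have "\<dots> = (\<Sum>j\<in>{0..e}. fps_nth f j * fps_nth g (e - j))"
      by (rule sum.reindex_bij_witness[of _ "\<lambda>j. j + (i + s)" "\<lambda>j. j - (i + s)"])
         (use True in \<open>auto simp: e_def intro!: arg_cong[of _ _ "fps_nth g"]\<close>)
    finally have "(\<Sum>j<k. ?u j) = fps_nth (f * g) e" by (simp only: fps_mult_nth)
    moreover have "?H $$ (i, l) = fps_nth (f * g) e"
      using i l True by (simp add: shifted_toeplitz_def e_def)
    ultimately show ?thesis by (simp only: prod)
  next
    case False
    then have "(\<Sum>j<k. ?u j) = 0" by (intro sum.neutral) auto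
    moreover have "?H $$ (i, l) = 0" using False i l by (simp add: shifted_toeplitz_def)
    ultimately show ?thesis by (simp only: prod)
  qed
qed (simp_all add: shifted_toeplitz_def)

lemma shifted_toeplitz_absorb_shift:
  "shifted_toeplitz r c s (fps_nth f) = shifted_toeplitz r c 0 (fps_nth (fps_X ^ s * f))"
  for f :: "'a::field fps"
  by (rule eq_matI) (auto simp: shifted_toeplitz_def fps_X_power_mult_nth)

lemma shifted_toeplitz_add:
  "shifted_toeplitz r c s (fps_nth f) + shifted_toeplitz r c s (fps_nth g)
     = shifted_toeplitz r c s (fps_nth (f + g))"
  for f g :: "'a::field fps"
  by (rule eq_matI) (auto simp: shifted_toeplitz_def)

lemma shifted_toeplitz_eq_iff:
  fixes x y :: "nat \<Rightarrow> 'a::zero"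
  assumes "0 < r"
  shows "shifted_toeplitz r c s x = shifted_toeplitz r c s y \<longleftrightarrow> (\<forall>i<c - s. x i = y i)"
proof
  assume eq: "shifted_toeplitz r c s x = shifted_toeplitz r c s y"
  show "\<forall>i<c - s. x i = y i"
  proof (intro allI impI)
    fix i assume "i < c - s"
    with assms arg_cong[OF eq, of "\<lambda>M. M $$ (0, i + s)"] show "x i = y i"
      by (simp add: shifted_toeplitz_def)
  qed
qed (auto simp: shifted_toeplitz_def)

lemma four_block_mat_inject:
  assumes "A \<in> carrier_mat r1 c1" "B \<in> carrier_mat r1 c2" "C \<in> carrier_mat r2 c1" "D \<in> carrier_mat r2 c2"
    and "A' \<in> carrier_mat r1 c1" "B' \<in> carrier_mat r1 c2" "C' \<in> carrier_mat r2 c1" "D' \<in> carrier_mat r2 c2"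
  shows "four_block_mat A B C D = four_block_mat A' B' C' D' \<longleftrightarrow> A = A' \<and> B = B' \<and> C = C' \<and> D = D'"
proof
  assume eq: "four_block_mat A B C D = four_block_mat A' B' C' D'"
  have ent: "four_block_mat A B C D $$ (i, j) = four_block_mat A' B' C' D' $$ (i, j)" for i j
    by (simp add: eq)
  note c = assms[unfolded carrier_mat_def, simplified]
  have "A = A'"
  proof (rule eq_matI)
    fix i j assume "i < dim_row A'" "j < dim_col A'"
    with ent[of i j] c show "A $$ (i, j) = A' $$ (i, j)" by simp
  qed (use c in auto)
  moreover have "B = B'"
  proof (rule eq_matI)
    fix i j assume "i < dim_row B'" "j < dim_col B'"
    with ent[of i "j + c1"] c show "B $$ (i, j) = B' $$ (i, j)" by simp
  qed (use c in auto)
  moreover have "C = C'"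
  proof (rule eq_matI)
    fix i j assume "i < dim_row C'" "j < dim_col C'"
    with ent[of "i + r1" j] c show "C $$ (i, j) = C' $$ (i, j)" by simp
  qed (use c in auto)
  moreover have "D = D'"
  proof (rule eq_matI)
    fix i j assume "i < dim_row D'" "j < dim_col D'"
    with ent[of "i + r1" "j + c1"] c show "D $$ (i, j) = D' $$ (i, j)" by simp
  qed (use c in auto)
  ultimately show "A = A' \<and> B = B' \<and> C = C' \<and> D = D'" by blast
qed simp

lemma direct_sum_eq_four_block:
  assumes "A \<in> carrier_mat k k" "B \<in> carrier_mat l l"
  shows "A \<oplus>\<^sub>d B = four_block_mat A (0\<^sub>m k l) (0\<^sub>m l k) B"
proof -
  have "A \<oplus>\<^sub>d B = four_block_mat A (0\<^sub>m (dim_row A) (dim_col B)) (0\<^sub>m (dim_row B) (dim_col A)) B"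
    by (simp only: direct_sum_mat_def diag_block_mat.simps(2)[of A "[B]"] diag_block_mat_singleton Let_def)
  with assms show ?thesis by simp
qed

section \<open>The centralizer of the Jordan matrix\<close>

text \<open>
  The endomorphism ring of the module \<open>F[x]/x^m \<oplus> F[x]/x^n\<close>, on which \<open>x\<close> acts as
  \<open>J_sum m n\<close>. In terms of the generators, which are the last basis vectors of the two blocks,
  this matrix is the \<open>2 \<times> 2\<close> matrix with rows \<open>(a, X^(m - n) b)\<close> and \<open>(c, d)\<close>. Power series
  rather than polynomials are used because their units can be inverted.
\<close>
definition endo :: "nat \<Rightarrow> nat \<Rightarrow> 'a::field fps \<Rightarrow> 'a fps \<Rightarrow> 'a fps \<Rightarrow> 'a fps \<Rightarrow> 'a mat" where
  "endo m n a b c d = T_mat m n (fps_nth a) (fps_nth b) (fps_nth c) (fps_nth d)"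

lemma endo_carrier [simp]: "endo m n a b c d \<in> carrier_mat (m + n) (m + n)"
  by (simp add: endo_def T_mat_def)

lemma endo_eq_iff:
  assumes "0 < n" "n < m"
  shows "endo m n a b c d = endo m n a' b' c' d' \<longleftrightarrow>
    fps_X ^ m dvd a - a' \<and> fps_X ^ n dvd b - b' \<and> fps_X ^ n dvd c - c' \<and> fps_X ^ n dvd d - d'"
proof -
  have "endo m n a b c d = endo m n a' b' c' d' \<longleftrightarrow>
      (\<forall>i<m. fps_nth a i = fps_nth a' i) \<and> (\<forall>i<n. fps_nth b i = fps_nth b' i) \<and>
      (\<forall>i<n. fps_nth c i = fps_nth c' i) \<and> (\<forall>i<n. fps_nth d i = fps_nth d' i)"
    unfolding endo_def T_mat_def
    using assms
    by (subst four_block_mat_inject[where ?r1.0=m and ?r2.0=n and ?c1.0=m and ?c2.0=n])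
       (auto simp: shifted_toeplitz_eq_iff)
  then show ?thesis by (simp add: fps_X_power_dvd_iff)
qed

lemma endo_mult:
  assumes "n < m"
  shows "endo m n a b c d * endo m n a' b' c' d' =
    endo m n (a * a' + fps_X ^ (m - n) * (b * c')) (a * b' + b * d')
             (c * a' + d * c') (fps_X ^ (m - n) * (c * b') + d * d')"
proof -
  have QR: "shifted_toeplitz m n 0 (fps_nth b) * shifted_toeplitz n m (m - n) (fps_nth c')
      = shifted_toeplitz m m 0 (fps_nth (fps_X ^ (m - n) * (b * c')))"
    using assms by (subst shifted_toeplitz_mult) (simp_all flip: shifted_toeplitz_absorb_shift)
  have RQ: "shifted_toeplitz n m (m - n) (fps_nth c) * shifted_toeplitz m n 0 (fps_nth b')
      = shifted_toeplitz n n 0 (fps_nth (fps_X ^ (m - n) * (c * b')))"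
    using assms by (subst shifted_toeplitz_mult) (simp_all flip: shifted_toeplitz_absorb_shift)
  show ?thesis
    unfolding endo_def T_mat_def
    using assms
    by (subst mult_four_block_mat[where ?nr1.0=m and ?nr2.0=n and ?n1.0=m and ?n2.0=n and ?nc1.0=m and ?nc2.0=n])
       (simp_all only: shifted_toeplitz_carrier QR RQ shifted_toeplitz_mult shifted_toeplitz_add
          add_0_right add_0_left le_add1 le_add2 le_add_diff_inverse less_imp_le order_refl)
qed

lemma endo_diagonal:
  "endo m n a 0 0 d = shifted_toeplitz m m 0 (fps_nth a) \<oplus>\<^sub>d shifted_toeplitz n n 0 (fps_nth d)"
proof -
  have 0: "shifted_toeplitz r c s (fps_nth 0) = 0\<^sub>m r c" for r c s
    by (rule eq_matI) (auto simp: shifted_toeplitz_def)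
  show ?thesis
    by (simp add: endo_def T_mat_def direct_sum_eq_four_block[of _ m _ n] 0)
qed

lemma J_sum_eq_endo: "J_sum m n = (endo m n fps_X 0 0 fps_X :: 'a::field mat)"
proof -
  have "jordan_block k (0::'a) = shifted_toeplitz k k 0 (fps_nth fps_X)" for k
    by (rule eq_matI) (auto simp: shifted_toeplitz_def)
  then show ?thesis by (simp add: endo_diagonal J_sum_def)
qed

lemma one_eq_endo: "1\<^sub>m (m + n) = (endo m n 1 0 0 1 :: 'a::field mat)"
proof -
  have one: "1\<^sub>m k = (shifted_toeplitz k k 0 (fps_nth 1) :: 'a mat)" for k
    by (rule eq_matI) (auto simp: shifted_toeplitz_def)
  then show ?thesis
    by (simp add: endo_diagonal direct_sum_eq_four_block[of _ m _ n] flip: one)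
qed

lemma endo_commutes_J_sum:
  assumes "n < m"
  shows "endo m n a b c d * J_sum m n = J_sum m n * endo m n a b c d"
  using assms by (simp add: J_sum_eq_endo endo_mult mult.commute)

text \<open>
  Commuting with the nilpotent blocks makes \<open>Y\<close> constant along diagonals, with zeros in the
  first column below the corner and in the last row before its final entry. A diagonal that
  meets one of these zeros vanishes; each of the others is one coefficient of the power series.
  The offset \<open>c - r\<close> is truncated, so it is \<open>0\<close> for a tall matrix.
\<close>
lemma jordan_block_commutant:
  fixes Y :: "'a::field mat"
  assumes Y: "Y \<in> carrier_mat r c"
    and comm: "jordan_block r 0 * Y = Y * jordan_block c 0"
  shows "\<exists>f. Y = shifted_toeplitz r c (c - r) (fps_nth f)"
proof -
  have JY: "(jordan_block r 0 * Y) $$ (i, j) = (if Suc i < r then Y $$ (Suc i, j) else 0)"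
    if "i < r" "j < c" for i j
  proof -
    have "(jordan_block r 0 * Y) $$ (i, j) = (\<Sum>l<r. jordan_block r 0 $$ (i, l) * Y $$ (l, j))"
      using that Y by (simp add: scalar_prod_def atLeast0LessThan)
    also have "\<dots> = (\<Sum>l<r. (if l = Suc i then Y $$ (l, j) else 0))"
      using that by (intro sum.cong) auto
    finally show ?thesis by simp
  qed
  have YJ: "(Y * jordan_block c 0) $$ (i, j) = (if 0 < j then Y $$ (i, j - 1) else 0)"
    if "i < r" "j < c" for i j
  proof -
    have "(Y * jordan_block c 0) $$ (i, j) = (\<Sum>l<c. Y $$ (i, l) * jordan_block c 0 $$ (l, j))"
      using that Y by (simp add: scalar_prod_def atLeast0LessThan)
    also have "\<dots> = (\<Sum>l<c. (if l = j - 1 then (if 0 < j then Y $$ (i, l) else 0) else 0))"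
      using that by (intro sum.cong) auto
    finally show ?thesis using that by auto
  qed
  have step: "(if Suc i < r then Y $$ (Suc i, j) else 0) = (if 0 < j then Y $$ (i, j - 1) else 0)"
    if "i < r" "j < c" for i j
    using JY[OF that] YJ[OF that] by (simp add: comm)
  have diag: "Y $$ (i + t, j + t) = Y $$ (i, j)" if "i + t < r" "j + t < c" for i j t
    using that
  proof (induction t)
    case (Suc t)
    then show ?case using step[of "i + t" "Suc (j + t)"] by simp
  qed simp
  have low: "Y $$ (i, j) = 0" if "i < r" "j < c" "j < i" for i j
  proof -
    from that have "i - Suc j < r" "0 < c" "i - j < r" "Suc (i - Suc j) = i - j" by auto
    with step[of "i - Suc j" 0] have "Y $$ (i - j, 0) = 0" using that by simp
    with that diag[of "i - j" j 0] show ?thesis by simp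
  qed
  have right: "Y $$ (i, j) = 0" if "i < r" "i \<le> j" "j < i + (c - r)" for i j
    using that step[of "r - 1" "Suc j + (r - 1 - i)"] diag[of i "r - 1 - i" j] by simp
  define f where "f = Abs_fps (\<lambda>k. Y $$ (0, k + (c - r)))"
  have "Y = shifted_toeplitz r c (c - r) (fps_nth f)"
  proof (rule eq_matI)
    fix i j
    assume "i < dim_row (shifted_toeplitz r c (c - r) (fps_nth f))"
      and "j < dim_col (shifted_toeplitz r c (c - r) (fps_nth f))"
    then have ij: "i < r" "j < c" by (simp_all add: shifted_toeplitz_def)
    show "Y $$ (i, j) = shifted_toeplitz r c (c - r) (fps_nth f) $$ (i, j)"
    proof (cases "i + (c - r) \<le> j")
      case True
      then show ?thesis
        using ij diag[of 0 i "j - i"] by (simp add: shifted_toeplitz_def f_def)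
    next
      case False
      then show ?thesis
        using ij low[of i j] right[of i j] by (cases "j < i") (simp_all add: shifted_toeplitz_def)
    qed
  qed (use Y in \<open>auto simp: shifted_toeplitz_def\<close>)
  then show ?thesis by blast
qed

lemma J_sum_commutant:
  fixes M :: "'a::field mat"
  assumes "n < m" and M: "M \<in> carrier_mat (m + n) (m + n)" and comm: "J_sum m n * M = M * J_sum m n"
  shows "\<exists>a b c d. M = endo m n a b c d"
proof -
  obtain P Q R S where sp: "split_block M m m = (P, Q, R, S)" by (metis prod_cases4)
  from split_block[OF this, of n n] M
  have PQRS: "P \<in> carrier_mat m m" "Q \<in> carrier_mat m n" "R \<in> carrier_mat n m" "S \<in> carrier_mat n n"
    and M_eq: "M = four_block_mat P Q R S" by auto
  let ?J = "\<lambda>k. jordan_block k (0::'a)"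
  have J: "J_sum m n = four_block_mat (?J m) (0\<^sub>m m n) (0\<^sub>m n m) (?J n)"
    by (simp add: J_sum_def direct_sum_eq_four_block)
  have "J_sum m n * M = four_block_mat (?J m * P) (?J m * Q) (?J n * R) (?J n * S)"
    unfolding J M_eq
    using PQRS
    by (subst mult_four_block_mat[OF _ _ _ _ PQRS, where ?nr1.0=m and ?nr2.0=n])
       (simp_all add: mult_carrier_mat[where n=m] mult_carrier_mat[where n=n])
  moreover have "M * J_sum m n = four_block_mat (P * ?J m) (Q * ?J n) (R * ?J m) (S * ?J n)"
    unfolding J M_eq
    using PQRS
    by (subst mult_four_block_mat[OF PQRS, where ?nc1.0=m and ?nc2.0=n])
       (simp_all add: mult_carrier_mat[where n=m] mult_carrier_mat[where n=n])
  ultimately have "four_block_mat (?J m * P) (?J m * Q) (?J n * R) (?J n * S)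
      = four_block_mat (P * ?J m) (Q * ?J n) (R * ?J m) (S * ?J n)"
    using comm by simp
  then have "?J m * P = P * ?J m" "?J m * Q = Q * ?J n" "?J n * R = R * ?J m" "?J n * S = S * ?J n"
    using four_block_mat_inject[of "?J m * P" m m "?J m * Q" n "?J n * R" n "?J n * S"
        "P * ?J m" "Q * ?J n" "R * ?J m" "S * ?J n"] PQRS
    by (simp_all add: mult_carrier_mat[where n=m] mult_carrier_mat[where n=n])
  then obtain a b c d where "P = shifted_toeplitz m m (m - m) (fps_nth a)"
    "Q = shifted_toeplitz m n (n - m) (fps_nth b)" "R = shifted_toeplitz n m (m - n) (fps_nth c)"
    "S = shifted_toeplitz n n (n - n) (fps_nth d)"
    using PQRS jordan_block_commutant by metis
  with \<open>n < m\<close> have "M = endo m n a b c d"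
    by (simp add: M_eq endo_def T_mat_def)
  then show ?thesis by blast
qed

section \<open>Similarity as congruences of power series\<close>

lemma similar_mat_wit_iff_intertwines:
  fixes Y :: "'a::field mat"
  assumes "Y * X = 1\<^sub>m N" "X * Y = 1\<^sub>m N"
    and "M \<in> carrier_mat N N" "M' \<in> carrier_mat N N" "Y \<in> carrier_mat N N" "X \<in> carrier_mat N N"
  shows "similar_mat_wit M' M Y X \<longleftrightarrow> Y * M = M' * Y"
proof
  assume "similar_mat_wit M' M Y X"
  then have "M' = Y * M * X" by (simp add: similar_mat_wit_def Let_def)
  then have "M' * Y = Y * M * (X * Y)" using assms by (simp add: assoc_mult_mat[of _ N N _ N _ N])
  with assms show "Y * M = M' * Y" by simp
next
  assume "Y * M = M' * Y"
  then have "Y * M * X = M' * (Y * X)" using assms by (simp add: assoc_mult_mat[of _ N N _ N _ N])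
  with assms show "similar_mat_wit M' M Y X" by (intro similar_mat_witI[of _ _ N]) simp_all
qed

text \<open>
  The four entries of \<open>U M = M' U\<close>, where \<open>U\<close> has rows \<open>(p, X^(m - n) q)\<close> and
  \<open>(t, w)\<close>; a factor \<open>X^(m - n)\<close> has been cancelled from the upper right one.
\<close>
definition intertwines ::
  "nat \<Rightarrow> nat \<Rightarrow> 'a::field fps \<Rightarrow> 'a fps \<Rightarrow> 'a fps \<Rightarrow> 'a fps \<Rightarrow> 'a fps \<Rightarrow> 'a fps \<Rightarrow> 'a fps \<Rightarrow> 'a fps
    \<Rightarrow> 'a fps \<Rightarrow> 'a fps \<Rightarrow> 'a fps \<Rightarrow> 'a fps \<Rightarrow> bool" where
  "intertwines m n p q t w a b c d a' b' c' d' \<longleftrightarrow>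
     fps_X ^ m dvd p * a + fps_X ^ (m - n) * (q * c) - (a' * p + fps_X ^ (m - n) * (b' * t)) \<and>
     fps_X ^ n dvd p * b + q * d - (a' * q + b' * w) \<and>
     fps_X ^ n dvd t * a + w * c - (c' * p + d' * t) \<and>
     fps_X ^ n dvd fps_X ^ (m - n) * (t * b) + w * d - (fps_X ^ (m - n) * (c' * q) + d' * w)"

lemma intertwines_iff_endo:
  assumes "0 < n" "n < m"
  shows "intertwines m n p q t w a b c d a' b' c' d' \<longleftrightarrow>
    endo m n p q t w * endo m n a b c d = endo m n a' b' c' d' * endo m n p q t w"
  using assms by (simp add: endo_mult endo_eq_iff intertwines_def)

text \<open>
  Transposing the \<open>2 \<times> 2\<close> matrices over power series turns \<open>U M = M' U\<close> into
  \<open>M\<^sup>T U\<^sup>T = U\<^sup>T M'\<^sup>T\<close>. Moving the factor \<open>X^(m - n)\<close> back to the upper right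
  corner exchanges \<open>b\<close> with \<open>c\<close>. This lets the second type inherit its uniqueness from
  the first.
\<close>
lemma intertwines_dual:
  "intertwines m n p q t w a b c d a' b' c' d' \<longleftrightarrow> intertwines m n p t q w a' c' b' d' a c b d"
proof -
  have flip: "f dvd x - y \<longleftrightarrow> f dvd y' - x'" if "x = x'" "y = y'" for f x y x' y' :: "'a fps"
    using that by (simp add: dvd_diff_commute)
  let ?S = "fps_X ^ (m - n) :: 'a fps"
  have "fps_X ^ m dvd p * a + ?S * (q * c) - (a' * p + ?S * (b' * t)) \<longleftrightarrow>
        fps_X ^ m dvd p * a' + ?S * (t * b') - (a * p + ?S * (c * q))"
    by (rule flip) (simp_all add: mult.commute)
  moreover have "fps_X ^ n dvd p * b + q * d - (a' * q + b' * w) \<longleftrightarrow>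
        fps_X ^ n dvd q * a' + w * b' - (b * p + d * q)"
    by (rule flip) (simp_all add: mult.commute)
  moreover have "fps_X ^ n dvd t * a + w * c - (c' * p + d' * t) \<longleftrightarrow>
        fps_X ^ n dvd p * c' + t * d' - (a * t + c * w)"
    by (rule flip) (simp_all add: mult.commute)
  moreover have "fps_X ^ n dvd ?S * (t * b) + w * d - (?S * (c' * q) + d' * w) \<longleftrightarrow>
        fps_X ^ n dvd ?S * (q * c') + w * d' - (?S * (b * t) + d * w)"
    by (rule flip) (simp_all add: mult.commute)
  ultimately show ?thesis unfolding intertwines_def by blast
qed

lemma similar_pair_sym: "similar_pair p q \<Longrightarrow> similar_pair q p"
  unfolding similar_pair_def by (meson similar_mat_wit_sym)

lemma similar_pair_trans: "similar_pair p q \<Longrightarrow> similar_pair q r \<Longrightarrow> similar_pair p r"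
  unfolding similar_pair_def by (meson similar_mat_wit_trans)

lemma decomposable_pair_similar:
  "similar_pair P Q \<Longrightarrow> decomposable_pair Q \<Longrightarrow> decomposable_pair P"
  unfolding decomposable_pair_def by (meson similar_pair_trans)

text \<open>
  The reduction modulo the radical is \<open>diag(p(0), w(0))\<close> because the off-diagonal product
  carries the positive power \<open>X^(m - n)\<close>. Hence the determinant is an invertible power
  series, and the adjugate divided by it is the inverse.
\<close>
lemma endo_unit_inverse:
  assumes "0 < n" "n < m" and p: "fps_nth p 0 \<noteq> 0" and w: "fps_nth w 0 \<noteq> 0"
  shows "\<exists>X. X \<in> carrier_mat (m + n) (m + n) \<and>
     endo m n p q t w * X = 1\<^sub>m (m + n) \<and> X * endo m n p q t w = 1\<^sub>m (m + n)"
proof -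
  define \<Delta> where "\<Delta> = p * w - fps_X ^ (m - n) * (q * t)"
  define u where "u = inverse \<Delta>"
  have "fps_nth \<Delta> 0 \<noteq> 0"
    using p w \<open>n < m\<close> by (simp add: \<Delta>_def fps_X_power_mult_nth)
  then have u: "u * (p * w - fps_X ^ (m - n) * (q * t)) = 1"
    unfolding u_def \<Delta>_def by (rule inverse_mult_eq_1)
  let ?X = "endo m n (u * w) (- (u * q)) (- (u * t)) (u * p)"
  have "endo m n p q t w * ?X = 1\<^sub>m (m + n)" and "?X * endo m n p q t w = 1\<^sub>m (m + n)"
    using u by (simp_all add: endo_mult[OF \<open>n < m\<close>] one_eq_endo algebra_simps)
  then show ?thesis using endo_carrier by blast
qed

text \<open>
  A matrix that fixes \<open>J_sum m n\<close> under conjugation lies in its centralizer, hence comes from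
  power series. Similarity of pairs with first component \<open>J_sum m n\<close> is thereby reduced to
  congruences between power series.
\<close>
lemma similar_pair_endo_iff:
  assumes "0 < n" "n < m"
  shows "similar_pair (J_sum m n, endo m n a b c d) (J_sum m n, endo m n a' b' c' d') \<longleftrightarrow>
    (\<exists>p q t w. fps_nth p 0 \<noteq> 0 \<and> fps_nth w 0 \<noteq> 0 \<and> intertwines m n p q t w a b c d a' b' c' d')"
    (is "similar_pair (?J, ?M) (?J, ?M') \<longleftrightarrow> _")
proof
  let ?N = "m + n"
  have J: "?J \<in> carrier_mat ?N ?N" by (simp add: J_sum_eq_endo)
  assume "similar_pair (?J, ?M) (?J, ?M')"
  then obtain X Y where JJ: "similar_mat_wit ?J ?J Y X" and MM: "similar_mat_wit ?M' ?M Y X"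
    by (auto simp: similar_pair_def)
  note D = similar_mat_witD2[OF J JJ]
  have "Y * ?J = ?J * Y" "X * ?J = ?J * X"
    using JJ similar_mat_wit_sym[OF JJ] D similar_mat_wit_iff_intertwines[of Y X ?N ?J ?J]
      similar_mat_wit_iff_intertwines[of X Y ?N ?J ?J] J by auto
  then obtain p q t w p' q' t' w' where Y: "Y = endo m n p q t w" and X: "X = endo m n p' q' t' w'"
    using J_sum_commutant[OF \<open>n < m\<close>] D by metis
  have "endo m n p q t w * endo m n p' q' t' w' = endo m n 1 0 0 1"
    using D by (simp add: X Y flip: one_eq_endo)
  then have "fps_X ^ m dvd p * p' + fps_X ^ (m - n) * (q * t') - 1"
    "fps_X ^ n dvd fps_X ^ (m - n) * (t * q') + w * w' - 1"
    using assms by (simp_all add: endo_mult endo_eq_iff)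
  then have "fps_nth p 0 * fps_nth p' 0 = 1" "fps_nth w 0 * fps_nth w' 0 = 1"
    using assms by (auto simp: fps_X_power_dvd_iff fps_X_power_mult_nth)
  moreover have "Y * ?M = ?M' * Y"
    using MM D similar_mat_wit_iff_intertwines[of Y X ?N ?M ?M'] by simp
  ultimately show "\<exists>p q t w. fps_nth p 0 \<noteq> 0 \<and> fps_nth w 0 \<noteq> 0 \<and> intertwines m n p q t w a b c d a' b' c' d'"
    using assms by (metis Y intertwines_iff_endo mult_zero_left zero_neq_one)
next
  assume "\<exists>p q t w. fps_nth p 0 \<noteq> 0 \<and> fps_nth w 0 \<noteq> 0 \<and> intertwines m n p q t w a b c d a' b' c' d'"
  then obtain p q t w where pw: "fps_nth p 0 \<noteq> 0" "fps_nth w 0 \<noteq> 0"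
    and int: "intertwines m n p q t w a b c d a' b' c' d'" by blast
  from endo_unit_inverse[OF assms pw] obtain X where X: "X \<in> carrier_mat (m + n) (m + n)"
    "endo m n p q t w * X = 1\<^sub>m (m + n)" "X * endo m n p q t w = 1\<^sub>m (m + n)" by blast
  have "similar_mat_wit ?J ?J (endo m n p q t w) X"
    using X endo_commutes_J_sum[OF \<open>n < m\<close>]
    by (subst similar_mat_wit_iff_intertwines) (simp_all add: J_sum_eq_endo)
  moreover have "similar_mat_wit ?M' ?M (endo m n p q t w) X"
    using X int by (subst similar_mat_wit_iff_intertwines) (simp_all add: intertwines_iff_endo[OF assms])
  ultimately show "similar_pair (?J, ?M) (?J, ?M')"
    by (auto simp: similar_pair_def)
qed

section \<open>Diagonalization and decomposability\<close>

text \<open>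
  Newton iteration at a root that is simple because \<open>e\<close> is a unit: replacing \<open>t\<close> by
  \<open>t - r / e\<close>, with \<open>r\<close> the current residue, gains at least one power of \<open>X\<close>, since
  \<open>v\<close> has no constant term.
\<close>
lemma riccati_solvable_mod_X_power:
  fixes e g v :: "'a::field fps"
  assumes e: "fps_nth e 0 \<noteq> 0" and v: "fps_nth v 0 = 0"
  shows "\<exists>t. fps_X ^ N dvd g + t * e - v * t ^ 2"
proof (induction N)
  case (Suc N)
  then obtain t \<rho> where t: "g + t * e - v * t ^ 2 = fps_X ^ N * \<rho>" by (auto elim: dvdE)
  obtain v' where v': "v = fps_X * v'"
    using v fps_X_power_dvd_iff[of 1 v] by (auto elim: dvdE)
  have e': "inverse e * e = 1" using e by (rule inverse_mult_eq_1)
  \<comment> \<open>The Newton correction: the residue divided by \<open>e\<close>.\<close>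
  define h where "h = fps_X ^ N * \<rho> * inverse e"
  have he: "h * e = fps_X ^ N * \<rho>" by (simp add: h_def mult.assoc e')
  have "g + (t - h) * e - v * (t - h) ^ 2
      = (g + t * e - v * t ^ 2) - h * e + v * h * (2 * t - h)"
    by (simp add: algebra_simps power2_eq_square)
  also have "\<dots> = fps_X ^ Suc N * (v' * \<rho> * inverse e * (2 * t - h))"
    unfolding t he by (simp add: v' h_def mult.commute mult.left_commute)
  finally show ?case by (metis dvd_triv_left)
qed simp

text \<open>
  After subtracting the scalar \<open>d\<close> and dividing by \<open>X^k\<close>, the reduction modulo \<open>X\<close> has the
  two distinct eigenvalues \<open>\<epsilon>(0)\<close> and \<open>0\<close>, so the endomorphism splits by Hensel's lemma.
  Concretely, a lower unitriangular conjugation clears \<open>c\<close> at the price of a Riccati equation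
  for \<open>t\<close>, and an upper unitriangular one then clears \<open>b\<close> by solving a linear equation for
  \<open>q\<close>. The intertwiner used here is the product of the two.
\<close>
lemma diagonalizable_if_difference_dominates:
  fixes a d \<beta> \<gamma> \<epsilon> :: "'a::field fps"
  assumes mn: "0 < n" "n < m"
    and \<epsilon>: "fps_nth \<epsilon> 0 \<noteq> 0" and ad: "a = d + fps_X ^ k * \<epsilon>"
  shows "\<exists>a' d'. similar_pair (J_sum m n, endo m n a (fps_X ^ k * \<beta>) (fps_X ^ k * \<gamma>) d)
                              (J_sum m n, endo m n a' 0 0 d')"
proof -
  let ?S = "fps_X ^ (m - n) :: 'a fps" and ?K = "fps_X ^ k :: 'a fps"
  have S0: "fps_nth ?S 0 = 0"
    using \<open>n < m\<close> by simp
  obtain t where "fps_X ^ n dvd \<gamma> + t * \<epsilon> - (?S * \<beta>) * t ^ 2"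
    using riccati_solvable_mod_X_power[OF \<epsilon>, of "?S * \<beta>"] S0 by auto
  then obtain \<rho> where \<rho>: "\<gamma> = fps_X ^ n * \<rho> - t * \<epsilon> + ?S * \<beta> * t ^ 2"
    by (auto elim!: dvdE simp: algebra_simps)
  \<comment> \<open>The value of \<open>(a - d) / X^k\<close> after \<open>c\<close> has been cleared.\<close>
  define \<delta> where "\<delta> = \<epsilon> - 2 * (?S * (\<beta> * t))"
  have "fps_nth \<delta> 0 \<noteq> 0" using \<epsilon> S0 by (simp add: \<delta>_def)
  define q where "q = \<beta> * inverse \<delta>"
  have q: "q * \<delta> = \<beta>"
    using inverse_mult_eq_1[OF \<open>fps_nth \<delta> 0 \<noteq> 0\<close>] by (simp add: q_def mult.assoc)
  define p where "p = 1 + ?S * (q * t)"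
  define a' where "a' = a - ?S * (?K * \<beta>) * t"
  define d' where "d' = d + ?S * (?K * \<beta>) * t"
  have z: "\<beta> - q * (\<epsilon> - 2 * (?S * (\<beta> * t))) = 0" using q by (simp add: \<delta>_def)
  \<comment> \<open>The second summand on the right vanishes by the choice of \<open>q\<close>, the first modulo \<open>X^m\<close> by that of \<open>t\<close>.\<close>
  have "p * a + ?S * (q * (?K * \<gamma>)) - (a' * p + ?S * (0 * t))
      = ?S * fps_X ^ n * (?K * (q * \<rho>)) + ?S * (?K * t) * (\<beta> - q * (\<epsilon> - 2 * (?S * (\<beta> * t))))"
    by (simp add: p_def a'_def \<rho> algebra_simps power2_eq_square)
  also have "\<dots> = fps_X ^ m * (?K * (q * \<rho>))"
    unfolding z using \<open>n < m\<close> by (simp flip: power_add)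
  finally have "fps_X ^ m dvd p * a + ?S * (q * (?K * \<gamma>)) - (a' * p + ?S * (0 * t))" by simp
  moreover have "p * (?K * \<beta>) + q * d - (a' * q + 0 * 1) = ?K * (\<beta> - q * (\<epsilon> - 2 * (?S * (\<beta> * t))))"
    by (simp add: p_def a'_def ad algebra_simps)
  moreover have "t * a + 1 * (?K * \<gamma>) - (0 * p + d' * t) = fps_X ^ n * (?K * \<rho>)"
    by (simp add: d'_def ad \<rho> algebra_simps power2_eq_square)
  ultimately have "intertwines m n p q t 1 a (?K * \<beta>) (?K * \<gamma>) d a' 0 0 d'"
    unfolding intertwines_def by (simp add: z) (simp add: d'_def algebra_simps)
  moreover have "fps_nth p 0 \<noteq> 0" using S0 by (simp add: p_def)
  ultimately show ?thesis
    using similar_pair_endo_iff[OF mn] by (metis fps_one_nth zero_neq_one)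
qed

lemma diagonal_endo_decomposable:
  assumes "0 < n" "n < m"
    and "similar_pair P (J_sum m n, endo m n a 0 0 d)"
  shows "decomposable_pair P"
  unfolding decomposable_pair_def
  using assms
  by (intro exI[of _ m] exI[of _ n] exI[of _ "jordan_block m 0"] exI[of _ "jordan_block n 0"]
      exI[of _ "shifted_toeplitz m m 0 (fps_nth a)"] exI[of _ "shifted_toeplitz n n 0 (fps_nth d)"])
     (auto simp: J_sum_def endo_diagonal)

section \<open>Reduction to the normal forms\<close>

lemma fps_split_at:
  fixes a :: "'a::field fps"
  obtains a' h where "a = a' + fps_X ^ l * h" "\<forall>i\<ge>l. fps_nth a' i = 0"
proof
  show "a = (a - fps_X ^ l * fps_shift l a) + fps_X ^ l * fps_shift l a" by simp
  show "\<forall>i\<ge>l. fps_nth (a - fps_X ^ l * fps_shift l a) i = 0"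
    by (simp add: fps_X_power_mult_nth)
qed

text \<open>
  Conjugation by \<open>diag(\<gamma>, 1)\<close> makes the lower left entry exactly \<open>X^k\<close>. Conjugation by
  the upper unitriangular matrix with entry \<open>X^(m - n) y\<close> adds \<open>X^(m - n + k) y\<close> to \<open>a\<close>,
  so a suitable \<open>y\<close> removes every coefficient of \<open>a\<close> from degree \<open>m - n + k\<close> on. The new
  \<open>b\<close> and \<open>d - a\<close> stay divisible by the required powers because \<open>m - n\<close> is positive.
\<close>
lemma reduce_to_type_I:
  fixes a \<beta> \<gamma> \<phi> :: "'a::field fps"
  assumes mn: "0 < n" "n < m" and \<gamma>: "fps_nth \<gamma> 0 \<noteq> 0"
  shows "\<exists>a' \<beta>' \<phi>'. fps_nth a' 0 = fps_nth a 0 \<and> (\<forall>i\<ge>m - n + k. fps_nth a' i = 0) \<and>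
    similar_pair (J_sum m n, endo m n a (fps_X ^ k * \<beta>) (fps_X ^ k * \<gamma>) (a + fps_X ^ Suc k * \<phi>))
                 (J_sum m n, endo m n a' (fps_X ^ k * \<beta>') (fps_X ^ k) (a' + fps_X ^ Suc k * \<phi>'))"
proof -
  obtain s where s: "m - n = Suc s" using \<open>n < m\<close> by (metis Suc_diff_Suc)
  obtain a' h where a: "a = a' + fps_X ^ (m - n + k) * h" and a': "\<forall>i\<ge>m - n + k. fps_nth a' i = 0"
    by (rule fps_split_at)
  let ?\<beta>' = "\<gamma> * \<beta> - h * (fps_X * \<phi> + fps_X ^ (m - n) * h)"
  let ?\<phi>' = "\<phi> + 2 * (fps_X ^ s * h)"
  have "intertwines m n \<gamma> (- h) 0 1 a (fps_X ^ k * \<beta>) (fps_X ^ k * \<gamma>) (a + fps_X ^ Suc k * \<phi>)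
          a' (fps_X ^ k * ?\<beta>') (fps_X ^ k) (a' + fps_X ^ Suc k * ?\<phi>')"
    unfolding intertwines_def s a by (simp add: algebra_simps power_add)
  moreover have "fps_nth a' 0 = fps_nth a 0"
    unfolding a s by (simp add: fps_X_power_mult_nth)
  ultimately show ?thesis
    using similar_pair_endo_iff[OF mn] a' \<gamma> by (metis fps_one_nth zero_neq_one)
qed

text \<open>
  The same reduction with the two off-diagonal entries exchanged: \<open>diag(1, \<beta>)\<close> normalizes
  \<open>b\<close>, and a lower unitriangular conjugation removes the high coefficients of \<open>a\<close>.
\<close>
lemma reduce_to_type_II:
  fixes a \<beta> \<gamma> \<phi> :: "'a::field fps"
  assumes mn: "0 < n" "n < m" and \<beta>: "fps_nth \<beta> 0 \<noteq> 0"
  shows "\<exists>a' \<gamma>' \<phi>'. fps_nth a' 0 = fps_nth a 0 \<and> (\<forall>i\<ge>m - n + k. fps_nth a' i = 0) \<and>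
    similar_pair (J_sum m n, endo m n a (fps_X ^ k * \<beta>) (fps_X ^ Suc k * \<gamma>) (a + fps_X ^ Suc k * \<phi>))
                 (J_sum m n, endo m n a' (fps_X ^ k) (fps_X ^ Suc k * \<gamma>') (a' + fps_X ^ Suc k * \<phi>'))"
proof -
  obtain s where s: "m - n = Suc s" using \<open>n < m\<close> by (metis Suc_diff_Suc)
  obtain a' h where a: "a = a' + fps_X ^ (m - n + k) * h" and a': "\<forall>i\<ge>m - n + k. fps_nth a' i = 0"
    by (rule fps_split_at)
  let ?\<gamma>' = "\<beta> * \<gamma> - h * (\<phi> + fps_X ^ s * h)"
  let ?\<phi>' = "\<phi> + 2 * (fps_X ^ s * h)"
  have "intertwines m n 1 0 h \<beta> a (fps_X ^ k * \<beta>) (fps_X ^ Suc k * \<gamma>) (a + fps_X ^ Suc k * \<phi>)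
          a' (fps_X ^ k) (fps_X ^ Suc k * ?\<gamma>') (a' + fps_X ^ Suc k * ?\<phi>')"
    unfolding intertwines_def s a by (simp add: algebra_simps power_add)
  moreover have "fps_nth a' 0 = fps_nth a 0"
    unfolding a s by (simp add: fps_X_power_mult_nth)
  ultimately show ?thesis
    using similar_pair_endo_iff[OF mn] a' \<beta> by (metis fps_one_nth zero_neq_one)
qed

text \<open>
  Taking the constant term of the upper left entry is multiplicative on the centralizer, again
  because \<open>m - n\<close> is positive.
\<close>
lemma endo_nilpotent_imp_constant_zero:
  fixes a b c d :: "'a::field fps"
  assumes mn: "0 < n" "n < m" and nil: "endo m n a b c d ^\<^sub>m l = 0\<^sub>m (m + n) (m + n)"
  shows "fps_nth a 0 = 0"
proof -
  have "\<exists>a' b' c' d'. endo m n a b c d ^\<^sub>m l = endo m n a' b' c' d' \<and> fps_nth a' 0 = fps_nth a 0 ^ l" for l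
  proof (induction l)
    case 0
    have "dim_row (endo m n a b c d) = m + n" using endo_carrier by blast
    then show ?case 
      by - (rule exI[of _ 1], rule exI[of _ 0], rule exI[of _ 0], rule exI[of _ 1], simp add: one_eq_endo)
  next
    case (Suc l)
    then obtain a' b' c' d' where IH: "endo m n a b c d ^\<^sub>m l = endo m n a' b' c' d'"
      "fps_nth a' 0 = fps_nth a 0 ^ l" by blast
    have "endo m n a b c d ^\<^sub>m Suc l = endo m n (a' * a + fps_X ^ (m - n) * (b' * c))
        (a' * b + b' * d) (c' * a + d' * c) (fps_X ^ (m - n) * (c' * b) + d' * d)"
      by (simp add: IH endo_mult[OF \<open>n < m\<close>])
    moreover have "fps_nth (a' * a + fps_X ^ (m - n) * (b' * c)) 0 = fps_nth a 0 ^ Suc l"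
      using IH \<open>n < m\<close> by (simp add: fps_X_power_mult_nth)
    ultimately show ?case by blast
  qed
  then obtain a' b' c' d' where *: "endo m n a b c d ^\<^sub>m l = endo m n a' b' c' d'"
    "fps_nth a' 0 = fps_nth a 0 ^ l" by blast
  have "0\<^sub>m (m + n) (m + n) = (endo m n 0 0 0 0 :: 'a mat)"
    by (rule eq_matI) (auto simp: endo_def T_mat_def shifted_toeplitz_def)
  with * nil have "fps_X ^ m dvd a'" using mn by (simp add: endo_eq_iff)
  with mn have "fps_nth a' 0 = 0" by (simp add: fps_X_power_dvd_iff)
  with * show ?thesis by simp
qed

lemma T_mat_cong:
  assumes "\<And>i. i < m \<Longrightarrow> a i = a' i" "\<And>i. i < n \<Longrightarrow> b i = b' i"
    "\<And>i. i < n \<Longrightarrow> c i = c' i" "\<And>i. i < n \<Longrightarrow> d i = d' i"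
    "n < m"
  shows "T_mat m n a b c d = T_mat m n a' b' c' d'"
  unfolding T_mat_def shifted_toeplitz_def
  using assms by (intro cong_four_block_mat cong_mat) auto

section \<open>The normal forms in terms of power series\<close>

text \<open>
  With \<open>k = n - r\<close>, the coefficient conditions of the first type say that \<open>a\<close> has degree below
  \<open>m - n + k\<close>, that \<open>b\<close> is divisible by \<open>X^k\<close> and \<open>d - a\<close> by \<open>X^(k+1)\<close>, and that
  \<open>c = X^k\<close>. Coefficients outside the matrix may be chosen freely, so these
  relations can be made exact instead of congruences.
\<close>
lemma type_I_eq:
  assumes "n < m" "k < n"
  shows "(type_I m n (n - k) :: ('a::field mat \<times> 'a mat) set) =
    {(J_sum m n, endo m n a (fps_X ^ k * \<beta>) (fps_X ^ k) (a + fps_X ^ Suc k * \<phi>)) | a \<beta> \<phi>.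
       fps_nth a 0 = 0 \<and> (\<forall>i\<ge>m - n + k. fps_nth a i = 0)}" (is "?L = ?R")
proof (intro equalityI subsetI)
  fix x :: "'a mat \<times> 'a mat"
  assume "x \<in> ?L"
  then obtain a b c d where x: "x = (J_sum m n, T_mat m n a b c d)" and a0: "a 0 = 0"
    and a: "\<forall>i. m - (n - k) \<le> i \<and> i \<le> m - 1 \<longrightarrow> a i = 0" and b: "\<forall>i < n - (n - k). b i = 0"
    and c: "\<forall>i < n. c i = (if i = n - (n - k) then 1 else 0)" and d: "\<forall>i \<le> n - (n - k). d i = a i"
    unfolding type_I_def by blast
  define \<alpha> where "\<alpha> = Abs_fps (\<lambda>i. if i < m - n + k then a i else 0)"
  define \<beta> where "\<beta> = Abs_fps (\<lambda>i. b (i + k))"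
  define \<phi> where "\<phi> = Abs_fps (\<lambda>i. d (i + Suc k) - fps_nth \<alpha> (i + Suc k))"
  have "T_mat m n a b c d = endo m n \<alpha> (fps_X ^ k * \<beta>) (fps_X ^ k) (\<alpha> + fps_X ^ Suc k * \<phi>)"
    unfolding endo_def
  proof (rule T_mat_cong)
    show "a i = fps_nth \<alpha> i" if "i < m" for i using a that assms by (auto simp: \<alpha>_def)
    show "b i = fps_nth (fps_X ^ k * \<beta>) i" if "i < n" for i
      using b that assms by (auto simp: \<beta>_def fps_X_power_mult_nth)
    show "c i = fps_nth (fps_X ^ k) i" if "i < n" for i using c that assms by simp
    show "d i = fps_nth (\<alpha> + fps_X ^ Suc k * \<phi>) i" if "i < n" for i
      using d that assms
      by (auto simp: \<alpha>_def \<phi>_def fps_X_power_mult_nth simp del: power_Suc)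
  qed fact
  moreover have "fps_nth \<alpha> 0 = 0" "\<forall>i\<ge>m - n + k. fps_nth \<alpha> i = 0" by (simp_all add: \<alpha>_def a0)
  ultimately show "x \<in> ?R" unfolding x by blast
next
  fix x :: "'a mat \<times> 'a mat"
  assume "x \<in> ?R"
  then obtain a \<beta> \<phi> where x: "x = (J_sum m n, endo m n a (fps_X ^ k * \<beta>) (fps_X ^ k) (a + fps_X ^ Suc k * \<phi>))"
    and a: "fps_nth a 0 = 0" "\<forall>i\<ge>m - n + k. fps_nth a i = 0" by blast
  show "x \<in> ?L"
    unfolding x type_I_def endo_def
    by (rule CollectI, intro exI conjI, rule refl)
       (use assms a in \<open>auto simp: fps_X_power_mult_nth simp del: power_Suc\<close>)
qed

lemma type_II_eq:
  assumes "n < m" "k < n"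
  shows "(type_II m n (n - k) :: ('a::field mat \<times> 'a mat) set) =
    {(J_sum m n, endo m n a (fps_X ^ k) (fps_X ^ Suc k * \<gamma>) (a + fps_X ^ Suc k * \<phi>)) | a \<gamma> \<phi>.
       fps_nth a 0 = 0 \<and> (\<forall>i\<ge>m - n + k. fps_nth a i = 0)}" (is "?L = ?R")
proof (intro equalityI subsetI)
  fix x :: "'a mat \<times> 'a mat"
  assume "x \<in> ?L"
  then obtain a b c d where x: "x = (J_sum m n, T_mat m n a b c d)" and a0: "a 0 = 0"
    and a: "\<forall>i. m - (n - k) \<le> i \<and> i \<le> m - 1 \<longrightarrow> a i = 0"
    and b: "\<forall>i < n. b i = (if i = n - (n - k) then 1 else 0)"
    and c: "\<forall>i \<le> n - (n - k). c i = 0" and d: "\<forall>i \<le> n - (n - k). d i = a i"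
    unfolding type_II_def by blast
  define \<alpha> where "\<alpha> = Abs_fps (\<lambda>i. if i < m - n + k then a i else 0)"
  define \<gamma> where "\<gamma> = Abs_fps (\<lambda>i. c (i + Suc k))"
  define \<phi> where "\<phi> = Abs_fps (\<lambda>i. d (i + Suc k) - fps_nth \<alpha> (i + Suc k))"
  have "T_mat m n a b c d = endo m n \<alpha> (fps_X ^ k) (fps_X ^ Suc k * \<gamma>) (\<alpha> + fps_X ^ Suc k * \<phi>)"
    unfolding endo_def
  proof (rule T_mat_cong)
    show "a i = fps_nth \<alpha> i" if "i < m" for i using a that assms by (auto simp: \<alpha>_def)
    show "b i = fps_nth (fps_X ^ k) i" if "i < n" for i using b that assms by simp
    show "c i = fps_nth (fps_X ^ Suc k * \<gamma>) i" if "i < n" for i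
      using c that assms by (auto simp: \<gamma>_def fps_X_power_mult_nth simp del: power_Suc)
    show "d i = fps_nth (\<alpha> + fps_X ^ Suc k * \<phi>) i" if "i < n" for i
      using d that assms
      by (auto simp: \<alpha>_def \<phi>_def fps_X_power_mult_nth simp del: power_Suc)
  qed fact
  moreover have "fps_nth \<alpha> 0 = 0" "\<forall>i\<ge>m - n + k. fps_nth \<alpha> i = 0" by (simp_all add: \<alpha>_def a0)
  ultimately show "x \<in> ?R" unfolding x by blast
next
  fix x :: "'a mat \<times> 'a mat"
  assume "x \<in> ?R"
  then obtain a \<gamma> \<phi> where x: "x = (J_sum m n, endo m n a (fps_X ^ k) (fps_X ^ Suc k * \<gamma>) (a + fps_X ^ Suc k * \<phi>))"
    and a: "fps_nth a 0 = 0" "\<forall>i\<ge>m - n + k. fps_nth a i = 0" by blast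
  show "x \<in> ?L"
    unfolding x type_II_def endo_def
    by (rule CollectI, intro exI conjI, rule refl)
       (use assms a in \<open>auto simp: fps_X_power_mult_nth simp del: power_Suc\<close>)
qed

section \<open>Uniqueness of the normal forms\<close>

text \<open>
  Modulo \<open>X^(k+1)\<close> both diagonal parts are scalar. The first congruence makes the two scalars
  agree, since the off-diagonal products carry the extra factor \<open>X^(m - n)\<close>; the second and
  third then compare the coefficients of degree \<open>k\<close> of \<open>b\<close> and \<open>c\<close>. These coefficients tell
  which value of \<open>r\<close> and which type a normal form has.
\<close>
lemma intertwines_leading_coefficients:
  fixes p q t w a b c d a' b' c' d' :: "'a::field fps"
  assumes mn: "n < m" and k: "k < n"
    and int: "intertwines m n p q t w a b c d a' b' c' d'"
    and p: "fps_nth p 0 \<noteq> 0" and w: "fps_nth w 0 \<noteq> 0"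
    and dvd: "fps_X ^ k dvd b" "fps_X ^ k dvd c" "fps_X ^ k dvd b'" "fps_X ^ k dvd c'"
    and scalar: "fps_X ^ Suc k dvd d - a" "fps_X ^ Suc k dvd d' - a'"
  shows "fps_nth p 0 * fps_nth b k = fps_nth w 0 * fps_nth b' k"
    and "fps_nth w 0 * fps_nth c k = fps_nth p 0 * fps_nth c' k"
proof -
  let ?D = "fps_X ^ Suc k :: 'a fps"
  let ?S = "fps_X ^ (m - n) :: 'a fps"
  obtain \<beta> \<gamma> \<beta>' \<gamma>' where e: "b = fps_X ^ k * \<beta>" "c = fps_X ^ k * \<gamma>"
    "b' = fps_X ^ k * \<beta>'" "c' = fps_X ^ k * \<gamma>'"
    using dvd by (auto elim!: dvdE)
  have le: "?D dvd f" if "fps_X ^ n dvd f \<or> fps_X ^ m dvd f" for f :: "'a fps"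
    using that k mn by (meson Suc_leI dvd_trans le_imp_power_dvd less_imp_le less_trans)
  obtain s where s: "m - n = Suc s" using mn by (metis Suc_diff_Suc)
  have "?D dvd p * a + ?S * (q * c) - (a' * p + ?S * (b' * t))"
    using int le by (simp add: intertwines_def)
  moreover have "p * a + ?S * (q * c) - (a' * p + ?S * (b' * t))
      = p * (a - a') + ?D * (fps_X ^ s * (q * \<gamma> - \<beta>' * t))"
    unfolding s e by (simp add: algebra_simps)
  ultimately have "?D dvd p * (a - a')"
    by (metis dvd_add_left_iff dvd_triv_left)
  then have aa': "?D dvd a - a'" by (rule fps_unit_cancel_dvd[OF p])
  have lead: "fps_nth u 0 * fps_nth f k = fps_nth v 0 * fps_nth g k"
    if D: "?D dvd u * f - v * g" and f: "fps_X ^ k dvd f" and g: "fps_X ^ k dvd g" for u v f g :: "'a fps"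
  proof -
    obtain f' g' where fg: "f = fps_X ^ k * f'" "g = fps_X ^ k * g'"
      using f g by (auto elim!: dvdE)
    have "u * f - v * g = fps_X ^ k * (u * f' - v * g')" by (simp add: fg algebra_simps)
    then have "fps_nth (u * f - v * g) k = fps_nth (u * f' - v * g') 0"
      by (simp only: fps_X_power_mult_nth) simp
    moreover have "fps_nth (u * f - v * g) k = 0"
      using D unfolding fps_X_power_dvd_iff by blast
    ultimately show ?thesis by (simp add: fg fps_X_power_mult_nth)
  qed
  have "?D dvd p * b + q * d - (a' * q + b' * w)"
    using int le by (simp add: intertwines_def)
  moreover have "p * b + q * d - (a' * q + b' * w) = (p * b - w * b') + (q * (d - a) + q * (a - a'))"
    by (simp add: algebra_simps)
  moreover have "?D dvd q * (d - a) + q * (a - a')" using aa' scalar by (intro dvd_add dvd_mult)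
  ultimately have "?D dvd p * b - w * b'" by (metis dvd_add_left_iff)
  with dvd show "fps_nth p 0 * fps_nth b k = fps_nth w 0 * fps_nth b' k" by (intro lead)
  have "?D dvd t * a + w * c - (c' * p + d' * t)"
    using int le by (simp add: intertwines_def)
  moreover have "t * a + w * c - (c' * p + d' * t) = (w * c - p * c') + (t * (a - a') - t * (d' - a'))"
    by (simp add: algebra_simps)
  moreover have "?D dvd t * (a - a') - t * (d' - a')" 
    by (intro dvd_diff[OF dvd_mult[OF aa'] dvd_mult[OF scalar(2)]])
  ultimately have "?D dvd w * c - p * c'" by (metis dvd_add_left_iff)
  with dvd show "fps_nth w 0 * fps_nth c k = fps_nth p 0 * fps_nth c' k" by (intro lead)
qed

text \<open>
  The degree bounds force \<open>a = a'\<close>, because \<open>p (a - a')\<close> is divisible by \<open>X^(m - n + k)\<close>.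
  Cancelling \<open>X^k\<close> leaves four congruences modulo \<open>X^(n - k)\<close>; eliminating \<open>q\<close>
  and \<open>\<beta> - \<beta>'\<close> from them leaves a unit times \<open>\<phi> - \<phi>'\<close>, so \<open>\<phi>\<close> is determined, and then
  \<open>\<beta>\<close> is as well.
\<close>
lemma type_I_parameters_unique:
  fixes p q t w a \<beta> \<phi> a' \<beta>' \<phi>' :: "'a::field fps"
  assumes mn: "n < m" and k: "k \<le> n"
    and int: "intertwines m n p q t w a (fps_X ^ k * \<beta>) (fps_X ^ k) (a + fps_X ^ k * \<phi>)
                a' (fps_X ^ k * \<beta>') (fps_X ^ k) (a' + fps_X ^ k * \<phi>')"
    and p: "fps_nth p 0 \<noteq> 0" and w: "fps_nth w 0 \<noteq> 0"
    and deg: "\<forall>i\<ge>m - n + k. fps_nth a i = 0" "\<forall>i\<ge>m - n + k. fps_nth a' i = 0"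
  shows "a = a'" and "fps_X ^ n dvd fps_X ^ k * \<beta> - fps_X ^ k * \<beta>'"
    and "fps_X ^ n dvd fps_X ^ k * \<phi> - fps_X ^ k * \<phi>'"
proof -
  define r where "r = n - k"
  let ?S = "fps_X ^ (m - n) :: 'a fps" and ?K = "fps_X ^ k :: 'a fps" and ?R = "fps_X ^ r :: 'a fps"
  have n: "fps_X ^ n = ?K * ?R" and m: "fps_X ^ m = (?S * ?K) * ?R"
    using mn k by (simp_all add: r_def flip: power_add)
  have K: "?K \<noteq> 0" and SK: "?S * ?K \<noteq> 0" by simp_all
  note int = int[unfolded intertwines_def]
  \<comment> \<open>For \<open>a = a'\<close>, the four defects of the intertwining relation divided by their evident powers of \<open>X\<close>.\<close>
  define r1 where "r1 = q - \<beta>' * t"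
  define r2 where "r2 = p * \<beta> + q * \<phi> - \<beta>' * w"
  define r3 where "r3 = w - p - \<phi>' * t"
  define r4 where "r4 = ?S * (t * \<beta> - q) + w * (\<phi> - \<phi>')"
  have "p * a + ?S * (q * ?K) - (a' * p + ?S * (?K * \<beta>' * t)) = p * (a - a') + ?S * ?K * r1"
    by (simp add: r1_def algebra_simps)
  with int have 1: "fps_X ^ m dvd p * (a - a') + ?S * ?K * r1" by metis
  then have "?S * ?K dvd p * (a - a') + ?S * ?K * r1" unfolding m by (rule dvd_mult_left)
  then have "?S * ?K dvd p * (a - a')" by (metis dvd_add_left_iff dvd_triv_left)
  then have "fps_X ^ (m - n + k) dvd a - a'"
    unfolding power_add by (rule fps_unit_cancel_dvd[OF p])
  with deg show a: "a = a'"
    by (intro fps_ext) (metis eq_iff_diff_eq_0 fps_X_power_dvd_iff fps_sub_nth not_le)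
  have R1: "?R dvd r1" using 1 SK by (simp add: a m)
  have "p * (?K * \<beta>) + q * (a + ?K * \<phi>) - (a' * q + ?K * \<beta>' * w) = ?K * r2"
    by (simp add: r2_def a algebra_simps)
  with int have R2: "?R dvd r2" using K by (metis n dvd_mult_cancel_left)
  have "t * a + w * ?K - (?K * p + (a' + ?K * \<phi>') * t) = ?K * r3"
    by (simp add: r3_def a algebra_simps)
  with int have R3: "?R dvd r3" using K by (metis n dvd_mult_cancel_left)
  have "?S * (t * (?K * \<beta>)) + w * (a + ?K * \<phi>) - (?S * (?K * q) + (a' + ?K * \<phi>') * w) = ?K * r4"
    by (simp add: r4_def a algebra_simps)
  with int have R4: "?R dvd r4" using K by (metis n dvd_mult_cancel_left)
  \<comment> \<open>This combination of the defects eliminates \<open>q\<close> and \<open>\<beta> - \<beta>'\<close>.\<close>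
  have "(p * w - ?S * (t * t * \<beta>')) * (\<phi> - \<phi>')
      = p * r4 + p * ?S * r1 - ?S * t * (r2 - r1 * \<phi> + \<beta>' * r3)"
    by (simp add: r1_def r2_def r3_def r4_def algebra_simps)
  moreover have "?R dvd p * r4 + p * ?S * r1 - ?S * t * (r2 - r1 * \<phi> + \<beta>' * r3)"
    using R1 R2 R3 R4 by (intro dvd_diff dvd_add dvd_mult dvd_mult2)
  moreover have "fps_nth (p * w - ?S * (t * t * \<beta>')) 0 \<noteq> 0" using p w mn by simp
  ultimately have \<phi>: "?R dvd \<phi> - \<phi>'" by (metis fps_unit_cancel_dvd)
  have "p * (\<beta> - \<beta>') = r2 - r1 * \<phi> + \<beta>' * r3 - \<beta>' * t * (\<phi> - \<phi>')"
    by (simp add: r1_def r2_def r3_def algebra_simps)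
  moreover have "?R dvd r2 - r1 * \<phi> + \<beta>' * r3 - \<beta>' * t * (\<phi> - \<phi>')"
    by (intro dvd_diff[OF dvd_add[OF dvd_diff[OF R2 dvd_mult2[OF R1]] dvd_mult[OF R3]] dvd_mult[OF \<phi>]])
  ultimately have \<beta>: "?R dvd \<beta> - \<beta>'" by (metis fps_unit_cancel_dvd p)
  show "fps_X ^ n dvd ?K * \<beta> - ?K * \<beta>'" "fps_X ^ n dvd ?K * \<phi> - ?K * \<phi>'"
    using \<phi> \<beta> by (simp_all add: n flip: right_diff_distrib)
qed

lemma type_I_similar_imp_eq:
  fixes P P' :: "'a::field mat \<times> 'a mat"
  assumes mn: "0 < n" "n < m" and k: "k < n"
    and "P \<in> type_I m n (n - k)" "P' \<in> type_I m n (n - k)" and sim: "similar_pair P P'"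
  shows "P = P'"
proof -
  from assms obtain a \<beta> \<phi> a' \<beta>' \<phi>' where
    P: "P = (J_sum m n, endo m n a (fps_X ^ k * \<beta>) (fps_X ^ k) (a + fps_X ^ Suc k * \<phi>))" and
    P': "P' = (J_sum m n, endo m n a' (fps_X ^ k * \<beta>') (fps_X ^ k) (a' + fps_X ^ Suc k * \<phi>'))" and
    deg: "\<forall>i\<ge>m - n + k. fps_nth a i = 0" "\<forall>i\<ge>m - n + k. fps_nth a' i = 0"
    by (auto simp: type_I_eq)
  obtain p q t w where pw: "fps_nth p 0 \<noteq> 0" "fps_nth w 0 \<noteq> 0" and
    "intertwines m n p q t w a (fps_X ^ k * \<beta>) (fps_X ^ k) (a + fps_X ^ k * (fps_X * \<phi>))
      a' (fps_X ^ k * \<beta>') (fps_X ^ k) (a' + fps_X ^ k * (fps_X * \<phi>'))"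
    using sim unfolding P P' similar_pair_endo_iff[OF mn] by (auto simp: algebra_simps)
  from type_I_parameters_unique[OF mn(2) less_imp_le[OF k] this(3) pw deg]
  show ?thesis unfolding P P' by (simp add: endo_eq_iff[OF mn] algebra_simps)
qed

text \<open>
  The dual intertwiner relates the transposed matrices in the opposite direction, and these have
  the shape covered by the uniqueness of the parameters of the first type.
\<close>
lemma type_II_similar_imp_eq:
  fixes P P' :: "'a::field mat \<times> 'a mat"
  assumes mn: "0 < n" "n < m" and k: "k < n"
    and "P \<in> type_II m n (n - k)" "P' \<in> type_II m n (n - k)" and sim: "similar_pair P P'"
  shows "P = P'"
proof -
  from assms obtain a \<gamma> \<phi> a' \<gamma>' \<phi>' where
    P: "P = (J_sum m n, endo m n a (fps_X ^ k) (fps_X ^ Suc k * \<gamma>) (a + fps_X ^ Suc k * \<phi>))" and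
    P': "P' = (J_sum m n, endo m n a' (fps_X ^ k) (fps_X ^ Suc k * \<gamma>') (a' + fps_X ^ Suc k * \<phi>'))" and
    deg: "\<forall>i\<ge>m - n + k. fps_nth a i = 0" "\<forall>i\<ge>m - n + k. fps_nth a' i = 0"
    by (auto simp: type_II_eq)
  obtain p q t w where pw: "fps_nth p 0 \<noteq> 0" "fps_nth w 0 \<noteq> 0" and
    "intertwines m n p q t w a (fps_X ^ k) (fps_X ^ k * (fps_X * \<gamma>)) (a + fps_X ^ k * (fps_X * \<phi>))
      a' (fps_X ^ k) (fps_X ^ k * (fps_X * \<gamma>')) (a' + fps_X ^ k * (fps_X * \<phi>'))"
    using sim unfolding P P' similar_pair_endo_iff[OF mn] by (auto simp: algebra_simps)
  from type_I_parameters_unique[OF mn(2) less_imp_le[OF k] this(3)[unfolded intertwines_dual[of m n p q]] pw deg(2,1)]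
  show ?thesis unfolding P P' by (simp add: endo_eq_iff[OF mn] dvd_diff_commute algebra_simps)
qed

lemma normal_form_shape:
  fixes P :: "'a::field mat \<times> 'a mat"
  assumes "n < m" "k < n" and "P \<in> type_I m n (n - k) \<union> type_II m n (n - k)"
  obtains a b c d where "P = (J_sum m n, endo m n a b c d)"
    "fps_X ^ k dvd b" "fps_X ^ k dvd c" "fps_X ^ Suc k dvd d - a"
    "P \<in> type_I m n (n - k) \<and> fps_nth c k = 1 \<or>
     P \<in> type_II m n (n - k) \<and> fps_nth c k = 0 \<and> fps_nth b k = 1"
proof (cases "P \<in> type_I m n (n - k)")
  case True
  then obtain a \<beta> \<phi> where
    "P = (J_sum m n, endo m n a (fps_X ^ k * \<beta>) (fps_X ^ k) (a + fps_X ^ Suc k * \<phi>))"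
    using assms by (auto simp: type_I_eq)
  with True show ?thesis by (intro that) auto
next
  case False
  then obtain a \<gamma> \<phi> where
    "P = (J_sum m n, endo m n a (fps_X ^ k) (fps_X ^ Suc k * \<gamma>) (a + fps_X ^ Suc k * \<phi>))"
    using assms by (auto simp: type_II_eq)
  moreover have "fps_nth (fps_X ^ Suc k * \<gamma>) k = 0"
    by (simp add: fps_X_power_mult_nth del: power_Suc)
  ultimately show ?thesis
    using False assms
    by (intro that[of a "fps_X ^ k" "fps_X ^ Suc k * \<gamma>" "a + fps_X ^ Suc k * \<phi>"])
       (auto simp: le_imp_power_dvd intro: dvd_mult2)
qed

text \<open>
  At degree \<open>k\<close>, the smaller of the two levels, the pair \<open>P\<close> has a nonzero off-diagonal
  coefficient, hence so does \<open>P'\<close>; this excludes \<open>k < l\<close>. Whether the coefficient of \<open>c\<close> vanishes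
  then decides the type.
\<close>
lemma normal_forms_similar_imp_eq_ordered:
  fixes P P' :: "'a::field mat \<times> 'a mat"
  assumes mn: "0 < n" "n < m" and kl: "k \<le> l" "l < n"
    and P: "P \<in> type_I m n (n - k) \<union> type_II m n (n - k)"
    and P': "P' \<in> type_I m n (n - l) \<union> type_II m n (n - l)"
    and sim: "similar_pair P P'"
  shows "P = P'"
proof -
  have k: "k < n" using kl by simp
  obtain a b c d where M: "P = (J_sum m n, endo m n a b c d)"
    "fps_X ^ k dvd b" "fps_X ^ k dvd c" "fps_X ^ Suc k dvd d - a"
    and cases: "P \<in> type_I m n (n - k) \<and> fps_nth c k = 1 \<or>
     P \<in> type_II m n (n - k) \<and> fps_nth c k = 0 \<and> fps_nth b k = 1"
    using normal_form_shape[OF mn(2) k P] .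
  obtain a' b' c' d' where M': "P' = (J_sum m n, endo m n a' b' c' d')"
    "fps_X ^ l dvd b'" "fps_X ^ l dvd c'" "fps_X ^ Suc l dvd d' - a'"
    and cases': "P' \<in> type_I m n (n - l) \<and> fps_nth c' l = 1 \<or>
     P' \<in> type_II m n (n - l) \<and> fps_nth c' l = 0 \<and> fps_nth b' l = 1"
    using normal_form_shape[OF mn(2) kl(2) P'] .
  have dvd': "fps_X ^ k dvd b'" "fps_X ^ k dvd c'" "fps_X ^ Suc k dvd d' - a'"
    using M'(2-4) kl(1) by (meson Suc_le_mono dvd_trans le_imp_power_dvd)+
  obtain p q t w where pw: "fps_nth p 0 \<noteq> 0" "fps_nth w 0 \<noteq> 0"
    and int: "intertwines m n p q t w a b c d a' b' c' d'"
    using sim unfolding M(1) M'(1) similar_pair_endo_iff[OF mn] by blast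
  have lead: "fps_nth p 0 * fps_nth b k = fps_nth w 0 * fps_nth b' k"
    "fps_nth w 0 * fps_nth c k = fps_nth p 0 * fps_nth c' k"
    using intertwines_leading_coefficients[OF mn(2) k int pw M(2,3) dvd'(1,2) M(4) dvd'(3)] .
  have "l = k"
  proof (rule ccontr)
    assume "l \<noteq> k"
    with kl have "k < l" by simp
    then have "fps_nth b' k = 0" "fps_nth c' k = 0"
      using M'(2,3) by (simp_all add: fps_X_power_dvd_iff)
    with lead pw cases show False by auto
  qed
  with lead pw cases cases' consider
    "P \<in> type_I m n (n - k)" "P' \<in> type_I m n (n - k)" |
    "P \<in> type_II m n (n - k)" "P' \<in> type_II m n (n - k)" by auto
  then show ?thesis
    using type_I_similar_imp_eq[OF mn k _ _ sim] type_II_similar_imp_eq[OF mn k _ _ sim] by cases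
qed

lemma normal_forms_altdef:
  "normal_forms m n = (\<Union>k<n. type_I m n (n - k) \<union> type_II m n (n - k))"
proof -
  have "{1..n} = (\<lambda>k. n - k) ` {..<n}"
  proof (intro equalityI subsetI)
    fix r assume "r \<in> {1..n}"
    then show "r \<in> (\<lambda>k. n - k) ` {..<n}" by (intro image_eqI[of _ _ "n - r"]) auto
  qed auto
  then show ?thesis by (simp add: normal_forms_def image_image)
qed

section \<open>Existence of a normal form\<close>

text \<open>
  Let \<open>k\<close> be the first degree in which \<open>b\<close>, \<open>c\<close> or \<open>a - d\<close> has a nonzero coefficient. If
  there is none below \<open>n\<close>, the matrix is already block diagonal; if \<open>a - d\<close> is nonzero there, it
  can be diagonalized. Otherwise \<open>c\<close> leads to the first type and, failing that, \<open>b\<close> leads to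
  the second.
\<close>
lemma endo_decomposable_or_similar_to_normal_form:
  fixes a b c d :: "'a::field fps"
  assumes mn: "0 < n" "n < m" and a0: "fps_nth a 0 = 0"
  shows "decomposable_pair (J_sum m n, endo m n a b c d) \<or>
    (\<exists>Q\<in>normal_forms m n. similar_pair (J_sum m n, endo m n a b c d) Q)"
    (is "decomposable_pair (?J, ?M) \<or> _")
proof -
  have refl: "similar_pair (?J, ?M) (?J, ?M)"
    by (simp add: similar_pair_def J_sum_eq_endo) (blast intro: similar_mat_wit_refl[OF endo_carrier])
  define bad where "bad i \<longleftrightarrow> n \<le> i \<or> fps_nth b i \<noteq> 0 \<or> fps_nth c i \<noteq> 0 \<or> fps_nth (a - d) i \<noteq> 0" for i
  define k where "k = (LEAST i. bad i)"
  have "bad n" by (simp add: bad_def)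
  then have k: "bad k" "k \<le> n" unfolding k_def by (auto intro: LeastI Least_le)
  have "\<not> bad i" if "i < k" for i using that unfolding k_def by (rule not_less_Least)
  then have "fps_X ^ k dvd b" "fps_X ^ k dvd c" "fps_X ^ k dvd a - d"
    unfolding fps_X_power_dvd_iff bad_def by blast+
  then obtain \<beta> \<gamma> \<epsilon> where b: "b = fps_X ^ k * \<beta>" and c: "c = fps_X ^ k * \<gamma>" and "a - d = fps_X ^ k * \<epsilon>"
    by (auto elim!: dvdE)
  then have a: "a = d + fps_X ^ k * \<epsilon>" by (simp add: algebra_simps)
  consider "k = n" | "fps_nth \<epsilon> 0 \<noteq> 0" | "k < n" "fps_nth \<epsilon> 0 = 0" using k(2) by force
  then show ?thesis
  proof cases
    case 1
    then have "?M = endo m n a 0 0 d" by (simp add: b c endo_eq_iff[OF mn])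
    with refl have "similar_pair (?J, ?M) (?J, endo m n a 0 0 d)" by simp
    then show ?thesis by (intro disjI1 diagonal_endo_decomposable[OF mn])
  next
    case 2
    from diagonalizable_if_difference_dominates[OF mn this a] diagonal_endo_decomposable[OF mn]
    show ?thesis unfolding b c by blast
  next
    case 3
    have X: "\<exists>g. f = fps_X * g" if "fps_nth f 0 = 0" for f :: "'a fps"
      using that fps_X_power_dvd_iff[of 1 f] by (auto elim: dvdE)
    obtain \<epsilon>' where "\<epsilon> = fps_X * \<epsilon>'" using X 3 by blast
    then have d: "d = a + fps_X ^ Suc k * (- \<epsilon>')" by (simp add: a algebra_simps)
    have lead: "fps_nth \<beta> 0 \<noteq> 0 \<or> fps_nth \<gamma> 0 \<noteq> 0"
      using k(1) 3 by (simp add: bad_def a b c fps_X_power_mult_nth)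
    have "\<exists>Q\<in>type_I m n (n - k) \<union> type_II m n (n - k). similar_pair (?J, ?M) Q"
    proof (cases "fps_nth \<gamma> 0 = 0")
      case False
      from reduce_to_type_I[OF mn False, of a k \<beta> "- \<epsilon>'"] obtain a' \<beta>' \<phi>' where
        "fps_nth a' 0 = fps_nth a 0" "\<forall>i\<ge>m - n + k. fps_nth a' i = 0"
        "similar_pair (?J, ?M) (?J, endo m n a' (fps_X ^ k * \<beta>') (fps_X ^ k) (a' + fps_X ^ Suc k * \<phi>'))"
        unfolding b[symmetric] c[symmetric] d[symmetric] by blast
      with a0 show ?thesis unfolding type_I_eq[OF mn(2) 3(1)] by fastforce
    next
      case True
      then obtain \<gamma>' where "\<gamma> = fps_X * \<gamma>'" using X by blast
      then have c': "c = fps_X ^ Suc k * \<gamma>'" by (simp add: c algebra_simps)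
      from True lead have "fps_nth \<beta> 0 \<noteq> 0" by simp
      from reduce_to_type_II[OF mn this, of a k \<gamma>' "- \<epsilon>'"] obtain a' \<gamma>'' \<phi>' where
        "fps_nth a' 0 = fps_nth a 0" "\<forall>i\<ge>m - n + k. fps_nth a' i = 0"
        "similar_pair (?J, ?M) (?J, endo m n a' (fps_X ^ k) (fps_X ^ Suc k * \<gamma>'') (a' + fps_X ^ Suc k * \<phi>'))"
        unfolding b[symmetric] c'[symmetric] d[symmetric] by blast
      with a0 show ?thesis unfolding type_II_eq[OF mn(2) 3(1)] by fastforce
    qed
    with 3 show ?thesis unfolding normal_forms_altdef by blast
  qed
qed

lemma commuting_nilpotent_pair_similar_to_endo:
  fixes A B :: "'a::field mat"
  assumes mn: "0 < n" "n < m" and AB: "commuting_nilpotent_pair (m + n) (A, B)"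
    and sim: "similar_mat A (J_sum m n)"
  shows "\<exists>a b c d. fps_nth a 0 = 0 \<and> similar_pair (A, B) (J_sum m n, endo m n a b c d)"
proof -
  let ?J = "J_sum m n :: 'a mat" and ?N = "m + n"
  have J: "?J \<in> carrier_mat ?N ?N" by (simp add: J_sum_eq_endo)
  from AB have A: "A \<in> carrier_mat ?N ?N" and B: "B \<in> carrier_mat ?N ?N" and comm: "A * B = B * A"
    and "nilpotent_mat B" by (simp_all add: commuting_nilpotent_pair_def)
  then obtain l where l: "B ^\<^sub>m l = 0\<^sub>m ?N ?N" by (auto simp: nilpotent_mat_def)
  obtain X Y where "similar_mat_wit A ?J X Y" using sim by (auto simp: similar_mat_def)
  then have JA: "similar_mat_wit ?J A Y X" by (rule similar_mat_wit_sym)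
  note D = similar_mat_witD2[OF J JA]
  define M where "M = Y * B * X"
  have M: "M \<in> carrier_mat ?N ?N" using D B by (simp add: M_def)
  have MB: "similar_mat_wit M B Y X" using D B M by (intro similar_mat_witI[of _ _ ?N]) (simp_all add: M_def)
  have YA: "Y * A = ?J * Y" using similar_mat_wit_iff_intertwines[of Y X ?N A ?J] D A J JA by simp
  have YB: "Y * B = M * Y" using similar_mat_wit_iff_intertwines[of Y X ?N B M] D B M MB by simp
  note assoc = assoc_mult_mat[of _ ?N ?N _ ?N _ ?N]
  have Y: "Y \<in> carrier_mat ?N ?N" using D by simp
  have "?J * M * Y = ?J * (Y * B)" using assoc[OF J M Y] YB by simp
  also have "\<dots> = Y * A * B" using assoc[OF J Y B] YA by simp
  also have "\<dots> = Y * B * A" using assoc[OF Y A B] assoc[OF Y B A] comm by simp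
  also have "\<dots> = M * (Y * A)" using assoc[OF M Y A] YB by simp
  also have "\<dots> = M * ?J * Y" using assoc[OF M J Y] YA by simp
  finally have "?J * M * Y * X = M * ?J * Y * X" by simp
  then have "?J * M = M * ?J"
    using D M J by (simp add: assoc_mult_mat[of _ ?N ?N _ ?N _ ?N])
  then obtain a b c d where M_eq: "M = endo m n a b c d" using J_sum_commutant[OF mn(2) M] by blast
  have "M ^\<^sub>m l = Y * B ^\<^sub>m l * X" using MB by (rule similar_mat_wit_pow_id)
  also have "\<dots> = 0\<^sub>m ?N ?N" using D l by simp
  finally have "fps_nth a 0 = 0" unfolding M_eq by (rule endo_nilpotent_imp_constant_zero[OF mn])
  moreover have "similar_pair (A, B) (?J, endo m n a b c d)"
    using JA MB unfolding M_eq similar_pair_def by auto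
  ultimately show ?thesis by blast
qed

lemma normal_forms_similar_iff_eq:
  fixes P Q :: "'a::field mat \<times> 'a mat"
  assumes mn: "0 < n" "n < m" and P: "P \<in> normal_forms m n" and Q: "Q \<in> normal_forms m n"
  shows "similar_pair P Q \<longleftrightarrow> P = Q"
proof
  assume sim: "similar_pair P Q"
  from P Q obtain k l where k: "k < n" "P \<in> type_I m n (n - k) \<union> type_II m n (n - k)"
    and l: "l < n" "Q \<in> type_I m n (n - l) \<union> type_II m n (n - l)"
    unfolding normal_forms_altdef by blast
  show "P = Q"
  proof (cases "k \<le> l")
    case True
    from normal_forms_similar_imp_eq_ordered[OF mn this l(1) k(2) l(2) sim] show ?thesis .
  next
    case False
    then have "l \<le> k" by simp
    from normal_forms_similar_imp_eq_ordered[OF mn this k(1) l(2) k(2) similar_pair_sym[OF sim]]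
    show ?thesis by simp
  qed
next
  have "fst P \<in> carrier_mat (m + n) (m + n)" "snd P \<in> carrier_mat (m + n) (m + n)"
    using P by (auto simp: normal_forms_def type_I_def type_II_def J_sum_eq_endo T_mat_def)
  then have "similar_pair P P" using similar_mat_wit_refl unfolding similar_pair_def by blast
  then show "similar_pair P Q" if "P = Q" using that by simp
qed

theorem theorem3p1:
  fixes m n :: nat
  assumes "1 \<le> n" and "n < m"
  shows "(\<forall>A B :: 'a::field mat.
            commuting_nilpotent_pair (m + n) (A, B) \<and> indecomposable_pair (A, B) \<and>
            similar_mat A (J_sum m n) \<longrightarrow>
            (\<exists>q \<in> normal_forms m n. similar_pair (A, B) q)) \<and>
         (\<forall>p \<in> (normal_forms m n :: ('a mat \<times> 'a mat) set). \<forall>q \<in> normal_forms m n.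
            similar_pair p q \<longleftrightarrow> p = q)"
proof (intro conjI allI ballI impI)
  from assms have mn: "0 < n" "n < m" by simp_all
  fix A B :: "'a mat"
  assume H: "commuting_nilpotent_pair (m + n) (A, B) \<and> indecomposable_pair (A, B) \<and>
            similar_mat A (J_sum m n)"
  then obtain a b c d where "fps_nth a 0 = 0" and sim: "similar_pair (A, B) (J_sum m n, endo m n a b c d)"
    using commuting_nilpotent_pair_similar_to_endo[OF mn] by blast
  with endo_decomposable_or_similar_to_normal_form[OF mn] decomposable_pair_similar[OF sim] H
  show "\<exists>q \<in> normal_forms m n. similar_pair (A, B) q" by (meson similar_pair_trans)
next
  fix p q :: "'a mat \<times> 'a mat"
  assume "p \<in> normal_forms m n" "q \<in> normal_forms m n"
  with assms show "similar_pair p q \<longleftrightarrow> p = q" by (intro normal_forms_similar_iff_eq) simp_all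
qed

end
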